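(* Let $m,p \in \mathbb{N}$ with $1\leq p \leq m$, and let $(x_{i})_{i=1}^{m}$ be a collection of complex numbers $x_{i} \in \mathbb{C}$. Then $$\sum_{\{I_{1},\dots,I_{p}\} \in \Pi_p(\{1,\dots,m\})} \ \prod_{j=1}^{p} \left(\sum_{i \in I_{j}} x_i\right)^{\vert I_{j} \vert -1} = \binom{m-1}{p-1} \left(\sum_{i=1}^{m} x_i \right)^{m-p},$$ where the sum on the left-hand side is over the set $\Pi_p(\{1, \dots,m\})$ of all partitions of $\{1,\dots,m\}$ into $p$ non-empty subsets.
   Context: $\Pi_p(S)$ denotes the set of all (unordered) partitions $\{I_1,\dots,I_p\}$ of a finite set $S$ into exactly $p$ non-empty, pairwise disjoint subsets (blocks) with union $S$. $\vert I\vert$ denotes the cardinality of $I$. A zeroth power is always $1$ (including $0^0=1$), i.e. both sides are read as polynomials in the $x_i$. *)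

theory Defs
  imports Complex_Main "HOL-Library.Disjoint_Sets"
begin

definition partitions_into :: "nat \<Rightarrow> 'a set \<Rightarrow> 'a set set set" where
  "partitions_into p S = {P. partition_on S P \<and> card P = p}"

end

theory Submission
  imports Defs "HOL-Analysis.Derivative"
begin

text \<open>
  Let \<open>A R t = t * (t + x(R)) ^ (card R - 1)\<close> (and \<open>A {} t = 1\<close>), where \<open>x(R)\<close> is the sum of \<open>x\<close>
  over \<open>R\<close>. Splitting off the block that contains a fixed element gives a recursion for
  the generating function of the left-hand sides in the number of blocks; the functions \<open>A\<close>
  satisfy the same recursion by Hurwitz's generalisation of Abel's binomial identity.
  Comparing coefficients of \<open>t ^ p\<close> in \<open>A {1..m} t\<close> gives the theorem.
\<close>

definition abel_poly :: "('a \<Rightarrow> complex) \<Rightarrow> 'a set \<Rightarrow> complex \<Rightarrow> complex" where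
  "abel_poly x R t = (if R = {} then 1 else t * (t + sum x R) ^ (card R - 1))"

section \<open>Sums over subsets and Hurwitz's identity\<close>

lemma sum_Pow_insert:
  fixes f :: "'a set \<Rightarrow> 'b::comm_monoid_add"
  assumes "finite R" "a \<notin> R"
  shows "(\<Sum>J\<in>Pow (insert a R). f J) = (\<Sum>J\<in>Pow R. f J) + (\<Sum>J\<in>Pow R. f (insert a J))"
proof -
  have "inj_on (insert a) (Pow R)"
    using assms(2) by (auto simp: inj_on_def)
  then have "(\<Sum>J\<in>insert a ` Pow R. f J) = (\<Sum>J\<in>Pow R. f (insert a J))"
    by (simp add: sum.reindex)
  then show ?thesis
    unfolding Pow_insert using assms by (subst sum.union_disjoint) auto
qed

text \<open>This is an iterated finite difference: each element \<open>a\<close> of \<open>R\<close>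
  applies the operator sending f(t) to f(t) - f(t + \<open>x a\<close>), which lowers the degree, so
  \<open>card R\<close> of them annihilate a power below \<open>card R\<close>.\<close>

lemma alternating_power_sum_eq_0:
  fixes x :: "'a \<Rightarrow> 'b::comm_ring_1"
  assumes "finite R" "k < card R"
  shows "(\<Sum>J\<in>Pow R. (-1) ^ card J * (t + sum x J) ^ k) = 0"
  using assms
proof (induction R arbitrary: k rule: finite_induct)
  case empty
  then show ?case by simp
next
  case (insert a R)
  define T where "T J i = (-1) ^ card J * (t + sum x J) ^ i" for J i
  \<comment> \<open>The k-th powers for \<open>J\<close> and \<open>insert a J\<close> cancel. Only
    powers i < k survive, and these satisfy i < \<open>card R\<close>, so the induction hypothesis
    covers them.\<close>
  have *: "T (insert a J) k = - T J k - (\<Sum>i<k. of_nat (k choose i) * x a ^ (k - i) * T J i)"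
    if "J \<in> Pow R" for J
  proof -
    have J: "finite J" "a \<notin> J"
      using that insert.hyps finite_subset by auto
    have "(t + sum x (insert a J)) ^ k = ((t + sum x J) + x a) ^ k"
      using J by (simp add: algebra_simps)
    also have "\<dots> = (\<Sum>i\<le>k. of_nat (k choose i) * (t + sum x J) ^ i * x a ^ (k - i))"
      by (rule binomial_ring)
    also have "\<dots> = (t + sum x J) ^ k + (\<Sum>i<k. of_nat (k choose i) * (t + sum x J) ^ i * x a ^ (k - i))"
      by (simp add: lessThan_Suc_atMost [symmetric])
    finally show ?thesis
      using J by (simp add: T_def algebra_simps sum_distrib_left sum_negf)
  qed
  have "(\<Sum>J\<in>Pow (insert a R). T J k)
      = (\<Sum>J\<in>Pow R. - (\<Sum>i<k. of_nat (k choose i) * x a ^ (k - i) * T J i))"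
    using insert.hyps by (simp add: sum_Pow_insert * sum_subtractf sum_negf)
  also have "\<dots> = - (\<Sum>i<k. of_nat (k choose i) * x a ^ (k - i) * (\<Sum>J\<in>Pow R. T J i))"
    by (simp add: sum_negf sum_distrib_left sum.swap [of _ "Pow R"])
  also have "\<dots> = 0"
    using insert.IH insert.prems insert.hyps by (auto simp: T_def intro!: sum.neutral)
  finally show ?case
    by (simp add: T_def)
qed

text \<open>Double counting of pairs (J, j) with j in J, with K = J - {j}. It serves to
  differentiate Hurwitz's sum, where the factor \<open>card J\<close> counts the choices of
  j.\<close>

lemma sum_Pow_remove_swap:
  fixes f :: "'a set \<Rightarrow> 'a \<Rightarrow> 'b::comm_monoid_add"
  assumes "finite R"
  shows "(\<Sum>J\<in>Pow R. \<Sum>j\<in>J. f J j) = (\<Sum>j\<in>R. \<Sum>K\<in>Pow (R - {j}). f (insert j K) j)"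
proof -
  have "(\<Sum>J\<in>Pow R. \<Sum>j\<in>J. f J j) = (\<Sum>(J, j)\<in>(SIGMA J:Pow R. J). f J j)"
    using assms by (subst sum.Sigma) (auto intro: finite_subset)
  also have "\<dots> = (\<Sum>(j, K)\<in>(SIGMA j:R. Pow (R - {j})). f (insert j K) j)"
    by (rule sum.reindex_bij_witness
        [where i = "\<lambda>(j, K). (insert j K, j)" and j = "\<lambda>(J, j). (j, J - {j})"])
      (auto simp: insert_absorb)
  also have "\<dots> = (\<Sum>j\<in>R. \<Sum>K\<in>Pow (R - {j}). f (insert j K) j)"
    using assms by (subst sum.Sigma) auto
  finally show ?thesis .
qed

text \<open>Both sides are polynomials in \<open>y\<close>. Their derivatives agree by induction on
  the sets \<open>R - {j}\<close>, so their difference is constant, and it suffices to find one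
  value of \<open>y\<close> where it vanishes. The induction must range over all \<open>y\<close>,
  because differentiating leads to the shifted arguments \<open>z + x j\<close>.\<close>

lemma hurwitz_identity:
  fixes x :: "'a \<Rightarrow> complex"
  assumes "finite R"
  shows "(\<Sum>J\<in>Pow R. (y + sum x J) ^ card J * abel_poly x (R - J) t) = (y + t + sum x R) ^ card R"
  using assms
proof (induction R arbitrary: y rule: finite_psubset_induct)
  case (psubset R)
  show ?case
  proof (cases "R = {}")
    case True
    then show ?thesis by (simp add: abel_poly_def)
  next
    case False
    define D where "D z = (\<Sum>J\<in>Pow R. (z + sum x J) ^ card J * abel_poly x (R - J) t)
      - (z + t + sum x R) ^ card R" for z
    have fin: "finite J" if "J \<subseteq> R" for J
      using that psubset.hyps finite_subset by auto
    have "(D has_field_derivative 0) (at z)" for z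
    proof -
      have "(\<Sum>J\<in>Pow R. of_nat (card J) * (z + sum x J) ^ (card J - 1) * abel_poly x (R - J) t)
          = (\<Sum>J\<in>Pow R. \<Sum>j\<in>J. (z + sum x J) ^ (card J - 1) * abel_poly x (R - J) t)"
        by (simp add: mult.assoc)
      also have "\<dots> = (\<Sum>j\<in>R. \<Sum>K\<in>Pow (R - {j}).
          (z + sum x (insert j K)) ^ (card (insert j K) - 1) * abel_poly x (R - insert j K) t)"
        using psubset.hyps by (rule sum_Pow_remove_swap)
      also have "\<dots> = (\<Sum>j\<in>R. \<Sum>K\<in>Pow (R - {j}).
          ((z + x j) + sum x K) ^ card K * abel_poly x ((R - {j}) - K) t)"
      proof (intro sum.cong refl)
        fix j K assume "j \<in> R" "K \<in> Pow (R - {j})"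
        then have "finite K" "j \<notin> K" "R - insert j K = (R - {j}) - K"
          using fin by auto
        then show "(z + sum x (insert j K)) ^ (card (insert j K) - 1) * abel_poly x (R - insert j K) t
            = ((z + x j) + sum x K) ^ card K * abel_poly x ((R - {j}) - K) t"
          by (simp add: add.assoc)
      qed
      also have "\<dots> = (\<Sum>j\<in>R. ((z + x j) + t + sum x (R - {j})) ^ card (R - {j}))"
        by (intro sum.cong refl psubset.IH) auto
      also have "\<dots> = (\<Sum>j\<in>R. (z + t + sum x R) ^ (card R - 1))"
        using psubset.hyps by (intro sum.cong refl) (simp add: sum.remove [of R _ x] algebra_simps)
      finally have eq: "(\<Sum>J\<in>Pow R. of_nat (card J) * (z + sum x J) ^ (card J - 1) * abel_poly x (R - J) t)
          = of_nat (card R) * (z + t + sum x R) ^ (card R - 1)"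
        by simp
      have "(D has_field_derivative
          (\<Sum>J\<in>Pow R. of_nat (card J) * (z + sum x J) ^ (card J - 1) * abel_poly x (R - J) t)
          - of_nat (card R) * (z + t + sum x R) ^ (card R - 1)) (at z)"
        unfolding D_def by (auto intro!: derivative_eq_intros sum.cong)
      then show ?thesis
        unfolding eq by simp
    qed
    then have "\<exists>c. \<forall>z\<in>UNIV. D z = c"
      by (intro has_field_derivative_zero_constant) auto
    then have const: "D y = D (- t - sum x R)"
      by auto
    text \<open>At this point the right-hand side vanishes, and the left-hand side is a finite difference
      of order \<open>card R\<close> of a polynomial of degree \<open>card R - 1\<close>.\<close>
    have "(\<Sum>J\<in>Pow R. (- t - sum x R + sum x J) ^ card J * abel_poly x (R - J) t)
        = (\<Sum>K\<in>Pow R. (- t - sum x R + sum x (R - K)) ^ card (R - K) * abel_poly x K t)"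
      by (rule sum.reindex_bij_witness [where i = "\<lambda>K. R - K" and j = "\<lambda>J. R - J"])
        (auto simp: double_diff)
    also have "\<dots> = (\<Sum>K\<in>Pow R. ((-1) ^ card R * t) * ((-1) ^ card K * (t + sum x K) ^ (card R - 1)))"
    proof (intro sum.cong refl)
      fix K assume "K \<in> Pow R"
      then have K: "K \<subseteq> R" "finite K" using fin by auto
      have le: "card K \<le> card R" using K psubset.hyps by (simp add: card_mono)
      have arg: "- t - sum x R + sum x (R - K) = - (t + sum x K)"
        using K psubset.hyps by (simp add: sum_diff)
      have card: "card (R - K) = card R - card K"
        using K by (simp add: card_Diff_subset)
      have sign: "(-1) ^ (card R - card K) = (-1 :: complex) ^ card R * (-1) ^ card K"
        using le by (auto simp: minus_one_power_iff)
      have base: "(- t - sum x R + sum x (R - K)) ^ card (R - K)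
          = (-1) ^ card R * (-1) ^ card K * (t + sum x K) ^ (card R - card K)"
        unfolding arg card power_minus [of "t + sum x K"] sign ..
      \<comment> \<open>The two exponents add up to \<open>card R - 1\<close> independently of
        \<open>K\<close>. For \<open>K = {}\<close> the value 1 of \<open>abel_poly\<close> leaves
        \<open>t ^ card R\<close>, one of whose factors supplies the missing
        \<open>t\<close>.\<close>
      have "(t + sum x K) ^ (card R - card K) * abel_poly x K t = t * (t + sum x K) ^ (card R - 1)"
      proof (cases "K = {}")
        case True
        then show ?thesis
          using False psubset.hyps
          by (cases "card R") (auto simp: abel_poly_def)
      next
        case False
        then have "card R - 1 = (card R - card K) + (card K - 1)"
          using K le by (cases "card K") auto
        with False show ?thesis
          by (simp add: abel_poly_def power_add)
      qed
      with base show "(- t - sum x R + sum x (R - K)) ^ card (R - K) * abel_poly x K t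
          = ((-1) ^ card R * t) * ((-1) ^ card K * (t + sum x K) ^ (card R - 1))"
        by (simp add: algebra_simps)
    qed
    also have "\<dots> = 0"
      using False psubset.hyps
      by (simp add: sum_distrib_left [symmetric] alternating_power_sum_eq_0 card_gt_0_iff)
    finally have "D (- t - sum x R) = 0"
      using False psubset.hyps by (simp add: D_def card_gt_0_iff)
    with const show ?thesis
      by (simp add: D_def)
  qed
qed

section \<open>Splitting off the block of a fixed element\<close>

lemma partition_on_insert_block:
  assumes "partition_on (R - J) Q" "J \<subseteq> R" "a \<notin> R"
  shows "partition_on (insert a R) (insert (insert a J) Q)"
    and "insert a J \<notin> Q"
    and "(THE I. I \<in> insert (insert a J) Q \<and> a \<in> I) = insert a J"
proof -
  have Q: "\<And>I. I \<in> Q \<Longrightarrow> I \<subseteq> R - J"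
    using assms(1) by (auto simp: partition_on_def)
  show "insert a J \<notin> Q"
    using Q assms by auto
  show "(THE I. I \<in> insert (insert a J) Q \<and> a \<in> I) = insert a J"
    using Q assms by (intro the_equality) auto
  show "partition_on (insert a R) (insert (insert a J) Q)"
    using assms Q unfolding partition_on_def disjoint_def by (auto; fast)
qed

lemma partition_on_remove_block:
  assumes "partition_on (insert a R) P" "a \<notin> R"
  defines "I \<equiv> THE I. I \<in> P \<and> a \<in> I"
  shows "I \<in> P" "a \<in> I" "I - {a} \<subseteq> R" "partition_on (R - (I - {a})) (P - {I})"
proof -
  obtain I' where I': "I' \<in> P" "a \<in> I'"
    using assms(1) by (auto simp: partition_on_def)
  have disj: "\<And>B. B \<in> P \<Longrightarrow> B \<noteq> I' \<Longrightarrow> B \<inter> I' = {}"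
    using assms(1) I' by (auto simp: partition_on_def disjoint_def)
  have "I = I'"
    unfolding I_def using I' disj by (intro the_equality) auto
  with I' show I: "I \<in> P" "a \<in> I" by auto
  show "I - {a} \<subseteq> R"
    using I assms(1) by (auto simp: partition_on_def)
  have "\<Union> (P - {I}) = \<Union> P - I"
    using disj I \<open>I = I'\<close> by auto
  also have "\<dots> = R - (I - {a})"
    using assms I by (auto simp: partition_on_def)
  finally show "partition_on (R - (I - {a})) (P - {I})"
    using assms(1) by (auto simp: partition_on_def disjoint_def)
qed

text \<open>A partition of \<open>insert a R\<close> amounts to a choice of the companions
  \<open>J\<close> of \<open>a\<close> in its block and a partition \<open>Q\<close> of the rest
  \<open>R - J\<close>. The two preceding lemmas show that these passages are mutually
  inverse.\<close>

lemma sum_partitions_insert: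
  fixes f :: "'a set set \<Rightarrow> 'b::comm_monoid_add"
  assumes "finite R" "a \<notin> R"
  shows "(\<Sum>P | partition_on (insert a R) P. f P)
       = (\<Sum>J\<in>Pow R. \<Sum>Q | partition_on (R - J) Q. f (insert (insert a J) Q))"
proof -
  let ?b = "\<lambda>P. THE I. I \<in> P \<and> a \<in> I"
  have "(\<Sum>P | partition_on (insert a R) P. f P)
      = (\<Sum>(J, Q)\<in>(SIGMA J:Pow R. {Q. partition_on (R - J) Q}). f (insert (insert a J) Q))"
  proof (rule sum.reindex_bij_witness
      [where j = "\<lambda>P. (?b P - {a}, P - {?b P})" and i = "\<lambda>(J, Q). insert (insert a J) Q"])
    fix P assume "P \<in> {P. partition_on (insert a R) P}"
    then have P: "partition_on (insert a R) P" by simp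
    note r = partition_on_remove_block [OF P assms(2)]
    show "(\<lambda>(J, Q). insert (insert a J) Q) (?b P - {a}, P - {?b P}) = P"
      using r by (simp add: insert_absorb)
    then show "(case (?b P - {a}, P - {?b P}) of (J, Q) \<Rightarrow> f (insert (insert a J) Q)) = f P"
      by simp
    show "(?b P - {a}, P - {?b P}) \<in> (SIGMA J:Pow R. {Q. partition_on (R - J) Q})"
      using r by simp
  next
    fix JQ assume "JQ \<in> (SIGMA J:Pow R. {Q. partition_on (R - J) Q})"
    then obtain J Q where JQ: "JQ = (J, Q)" "J \<subseteq> R" "partition_on (R - J) Q" by auto
    note i = partition_on_insert_block [OF JQ(3,2) assms(2)]
    have "a \<notin> J" using JQ assms by auto
    show "(\<lambda>(J, Q). insert (insert a J) Q) JQ \<in> {P. partition_on (insert a R) P}"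
      using i JQ by simp
    show "(?b ((\<lambda>(J, Q). insert (insert a J) Q) JQ) - {a},
        (\<lambda>(J, Q). insert (insert a J) Q) JQ - {?b ((\<lambda>(J, Q). insert (insert a J) Q) JQ)}) = JQ"
      using i \<open>a \<notin> J\<close> by (simp add: JQ(1))
  qed
  also have "\<dots> = (\<Sum>J\<in>Pow R. \<Sum>Q | partition_on (R - J) Q. f (insert (insert a J) Q))"
    using assms by (subst sum.Sigma) (auto simp: finitely_many_partition_on)
  finally show ?thesis .
qed

lemma sum_partitions_eq_abel_poly:
  fixes x :: "'a \<Rightarrow> complex"
  assumes "finite S"
  shows "(\<Sum>P | partition_on S P. t ^ card P * (\<Prod>I\<in>P. sum x I ^ (card I - 1))) = abel_poly x S t"
  using assms
proof (induction S rule: finite_psubset_induct)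
  case (psubset S)
  show ?case
  proof (cases "S = {}")
    case True
    then show ?thesis by (simp add: partition_on_empty abel_poly_def)
  next
    case False
    then obtain a where "a \<in> S" by auto
    define R where "R = S - {a}"
    have R: "S = insert a R" "a \<notin> R" "finite R"
      using \<open>a \<in> S\<close> psubset.hyps by (auto simp: R_def)
    define g where "g P = t ^ card P * (\<Prod>I\<in>P. sum x I ^ (card I - 1))" for P
    have "(\<Sum>P | partition_on S P. g P)
        = (\<Sum>J\<in>Pow R. \<Sum>Q | partition_on (R - J) Q. g (insert (insert a J) Q))"
      unfolding R(1) using R by (intro sum_partitions_insert)
    \<comment> \<open>The block \<open>insert a J\<close> has \<open>card J + 1\<close> elements, so
      its exponent is \<open>card J\<close>. This gives Hurwitz's sum at \<open>y = x a\<close>; the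
      remaining blocks partition a proper subset of \<open>S\<close>, so the induction hypothesis
      applies.\<close>
    also have "\<dots> = (\<Sum>J\<in>Pow R. t * ((x a + sum x J) ^ card J * abel_poly x (R - J) t))"
    proof (intro sum.cong refl)
      fix J assume "J \<in> Pow R"
      then have J: "J \<subseteq> R" "finite J" "a \<notin> J" using R finite_subset by auto
      have "(\<Sum>Q | partition_on (R - J) Q. g (insert (insert a J) Q))
          = (\<Sum>Q | partition_on (R - J) Q. t * (x a + sum x J) ^ card J * g Q)"
      proof (intro sum.cong refl)
        fix Q assume "Q \<in> {Q. partition_on (R - J) Q}"
        then have Q: "partition_on (R - J) Q" by simp
        have "finite Q" using Q R finite_elements by blast
        moreover have "insert a J \<notin> Q"
          using partition_on_insert_block(2) [OF Q J(1) R(2)] .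
        ultimately show "g (insert (insert a J) Q) = t * (x a + sum x J) ^ card J * g Q"
          using J by (simp add: g_def)
      qed
      also have "\<dots> = t * (x a + sum x J) ^ card J * abel_poly x (R - J) t"
        using psubset.IH [of "R - J"] R by (auto simp: sum_distrib_left [symmetric] g_def)
      finally show "(\<Sum>Q | partition_on (R - J) Q. g (insert (insert a J) Q))
          = t * ((x a + sum x J) ^ card J * abel_poly x (R - J) t)"
        by (simp add: mult.assoc)
    qed
    also have "\<dots> = t * (x a + t + sum x R) ^ card R"
      using R by (simp add: sum_distrib_left [symmetric] hurwitz_identity)
    also have "\<dots> = abel_poly x S t"
      using R by (simp add: abel_poly_def algebra_simps)
    finally show ?thesis by (simp add: g_def)
  qed
qed

section \<open>Comparison of coefficients\<close>

theorem theorem1: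
  fixes m p :: nat and x :: "nat \<Rightarrow> complex"
  assumes "1 \<le> p" and "p \<le> m"
  shows "(\<Sum>P \<in> partitions_into p {1..m}. \<Prod>I\<in>P. (\<Sum>i\<in>I. x i) ^ (card I - 1))
       = of_nat ((m - 1) choose (p - 1)) * (\<Sum>i = 1..m. x i) ^ (m - p)"
proof -
  define X where "X = (\<Sum>i = 1..m. x i)"
  define c where "c q = (\<Sum>P \<in> partitions_into q {1..m}. \<Prod>I\<in>P. sum x I ^ (card I - 1))" for q
  \<comment> \<open>These are the coefficients of \<open>t * (t + X) ^ (m - 1)\<close>. The case
    \<open>q = 0\<close> is separate because truncated subtraction would otherwise yield
    \<open>X ^ m\<close> there.\<close>
  define d where "d q = (if q = 0 then 0 else of_nat ((m - 1) choose (q - 1)) * X ^ (m - q))" for q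
  have m: "m = Suc (m - 1)" using assms by simp
  have "(\<Sum>q\<le>m. c q * t ^ q) = (\<Sum>q\<le>m. d q * t ^ q)" for t
  proof -
    \<comment> \<open>Blocks are non-empty and disjoint, so there are at most \<open>m\<close> of
      them. Grouping by \<open>q \<le> m\<close> therefore reaches every partition.\<close>
    have card_le: "card P \<le> m" if "partition_on {1..m} P" for P
    proof -
      have un: "\<Union>P = {1..m}"
        using partition_onD1 [OF that] by simp
      have fin: "finite I" if "I \<in> P" for I
        using that un by (metis Union_upper finite_atLeastAtMost finite_subset)
      have "card P = (\<Sum>I\<in>P. 1)"
        by simp
      also have "\<dots> \<le> (\<Sum>I\<in>P. card I)"
        using fin partition_onD3 [OF that] by (intro sum_mono) (metis One_nat_def Suc_leI card_gt_0_iff)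
      also have "\<dots> = card (\<Union>P)"
        using fin partition_onD2 [OF that]
        by (intro card_Union_disjoint [symmetric]) (auto simp: disjoint_def pairwise_def disjnt_def)
      finally show ?thesis
        by (simp add: un)
    qed
    have "(\<Sum>q\<le>m. c q * t ^ q) = (\<Sum>q\<le>m. \<Sum>P | P \<in> {P. partition_on {1..m} P} \<and> card P = q.
        t ^ card P * (\<Prod>I\<in>P. sum x I ^ (card I - 1)))"
      by (auto simp: c_def partitions_into_def sum_distrib_left mult.commute intro!: sum.cong)
    also have "\<dots> = (\<Sum>P | partition_on {1..m} P. t ^ card P * (\<Prod>I\<in>P. sum x I ^ (card I - 1)))"
      using card_le by (intro sum.group) (auto simp: finitely_many_partition_on)
    also have "\<dots> = t * (t + X) ^ (m - 1)"
      using assms by (subst sum_partitions_eq_abel_poly) (simp_all add: abel_poly_def X_def)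
    also have "\<dots> = (\<Sum>k\<le>m - 1. of_nat ((m - 1) choose k) * X ^ (m - 1 - k) * t ^ Suc k)"
      unfolding binomial_ring [of t X] by (simp add: sum_distrib_left mult_ac)
    also have "\<dots> = (\<Sum>k\<le>m - 1. d (Suc k) * t ^ Suc k)"
      by (simp add: d_def)
    also have "\<dots> = (\<Sum>q\<le>m. d q * t ^ q)"
      by (subst (2) m, subst sum.atMost_Suc_shift) (simp add: d_def)
    finally show ?thesis .
  qed
  \<comment> \<open>The two polynomials agree for every complex \<open>t\<close>, hence
    coefficientwise.\<close>
  then have "c p = d p"
    using assms(2) polyfun_eq_coeffs [of c m d] by blast
  then show ?thesis
    using assms(1) by (simp add: c_def d_def X_def)
qed

end
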